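(* Under the setting described in the context, the filtered process $\hat\Theta_n=\mathbb{E}[\Theta_n\mid\mathcal{F}^N_n]$ satisfies, almost surely, for all $n=1,\dots,\Gamma$, $$\hat\Theta_n=\sum_{\delta\in\mathbb{J}^\otimes}\frac{\widehat{(\tilde\Theta\lambda^\delta)}_{n-1}}{\hat\lambda^\delta_{n-1}}\,\mathbf 1_{[\Delta N_n=\delta]}.$$
   Context: Let $\Gamma\in\mathbb{N}$ and let $(\Omega,\mathbf{A},\mathbf F=(\mathcal{F}_n)_{n\in\{0,\dots,\Gamma\}},\mathbb{P})$ be a filtered probability space. $N=(N^1,\dots,N^\rho)$ is a discrete-time multivariate counting process, where each $N^i=(N^i_n)_{0\le n\le\Gamma}$ is an $\mathbf F$-adapted counting process starting from $0$; $\mathbf F^N=(\mathcal{F}^N_n)_n$ is the natural filtration of $N$ augmented with the $\mathbb{P}$-null sets. For $n\ge1$, $\Delta N^i_n=N^i_n-N^i_{n-1}$ and $\Delta N_n=(\Delta N^1_n,\dots,\Delta N^\rho_n)$. $\mathbb{J}_i\subset\mathbb{N}$ denotes the support of the jumps of $N^i$ (the set of possible values of $\Delta N^i_n$, taken constant in time), with $0\in\mathbb{J}_i$, and $\mathbb{J}^\otimes=\prod_{i=1}^\rho\mathbb{J}_i$. $\Theta=(\Theta_n)_{0\le n\le\Gamma}$ is a real-valued square integrable $\mathbf F$-adapted process such that, for every $n\ge1$, $\Theta_n$ and the vector $(\Delta N^i_n)_{i=1,\dots,\rho}$ are independent conditionally on $\mathcal{F}_{n-1}$. ($\Theta$ is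 not assumed to be a Markov chain.) Notation: for $n\in\{1,\dots,\Gamma\}$ and $\delta=(\delta_1,\dots,\delta_\rho)\in\mathbb{J}^\otimes$, $\{\Delta N_n=\delta\}=\bigcap_{i=1}^\rho\{\Delta N^i_n=\delta_i\}$, $\tilde\Theta_{n-1}=\mathbb{E}[\Theta_n\mid\mathcal{F}_{n-1}]$, $\lambda^\delta_{n-1}=\mathbb{E}[\mathbf 1_{[\Delta N_n=\delta]}\mid\mathcal{F}_{n-1}]$, $\hat\lambda^\delta_{n-1}=\mathbb{E}[\lambda^\delta_{n-1}\mid\mathcal{F}^N_{n-1}]$, and $\widehat{(\tilde\Theta\lambda^\delta)}_{n-1}=\mathbb{E}[\tilde\Theta_{n-1}\lambda^\delta_{n-1}\mid\mathcal{F}^N_{n-1}]$. A quotient with zero denominator is taken to be $0$ (almost surely this never occurs on the corresponding event $\{\Delta N_n=\delta\}$). *)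

theory Defs
  imports "HOL-Probability.Probability"
begin

text \<open>The locale \<open>filtration\<close> would constrain \<open>F n\<close> for all \<open>n\<close>; here there is a finite
  horizon \<open>\<Gamma>\<close>, and every \<open>F n\<close> must be a sub-\<open>\<sigma>\<close>-algebra of \<open>M\<close>.\<close>

definition discrete_filtration :: "'a measure \<Rightarrow> nat \<Rightarrow> (nat \<Rightarrow> 'a measure) \<Rightarrow> bool" where
  "discrete_filtration M \<Gamma> F \<longleftrightarrow>
     (\<forall>n\<le>\<Gamma>. subalgebra M (F n)) \<and> (\<forall>m n. m \<le> n \<longrightarrow> n \<le> \<Gamma> \<longrightarrow> subalgebra (F n) (F m))"

text \<open>Jumps of size larger than one are allowed. Since the paths are nondecreasing, the truncated
  subtraction of natural numbers used below for increments is the true difference.\<close>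

definition counting_process :: "'a set \<Rightarrow> nat \<Rightarrow> (nat \<Rightarrow> 'a \<Rightarrow> nat) \<Rightarrow> bool" where
  "counting_process \<Omega> \<Gamma> X \<longleftrightarrow>
     (\<forall>\<omega>\<in>\<Omega>. X 0 \<omega> = 0 \<and> (\<forall>m n. m \<le> n \<longrightarrow> n \<le> \<Gamma> \<longrightarrow> X m \<omega> \<le> X n \<omega>))"

definition increment :: "(nat \<Rightarrow> 'a \<Rightarrow> nat) \<Rightarrow> nat \<Rightarrow> 'a \<Rightarrow> nat" where
  "increment X n \<omega> = X n \<omega> - X (n - 1) \<omega>"

definition increment_support :: "'a measure \<Rightarrow> (nat \<Rightarrow> 'a \<Rightarrow> nat) \<Rightarrow> nat \<Rightarrow> nat set" where
  "increment_support M X n = {k. measure M {\<omega> \<in> space M. increment X n \<omega> = k} > 0}"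

text \<open>The components of a multivariate process are indexed by \<open>{1..\<rho>}\<close>; vectors are functions that
  are extensional on this index set, i.e. elements of \<open>{1..\<rho>} \<rightarrow>\<^sub>E UNIV\<close>.\<close>

definition increment_vec ::
    "nat \<Rightarrow> (nat \<Rightarrow> nat \<Rightarrow> 'a \<Rightarrow> nat) \<Rightarrow> nat \<Rightarrow> 'a \<Rightarrow> nat \<Rightarrow> nat" where
  "increment_vec \<rho> N n \<omega> = (\<lambda>i\<in>{1..\<rho>}. increment (N i) n \<omega>)"

definition increment_event ::
    "'a measure \<Rightarrow> nat \<Rightarrow> (nat \<Rightarrow> nat \<Rightarrow> 'a \<Rightarrow> nat) \<Rightarrow> nat \<Rightarrow> (nat \<Rightarrow> nat) \<Rightarrow> 'a set" where
  "increment_event M \<rho> N n \<delta> = {\<omega> \<in> space M. \<forall>i\<in>{1..\<rho>}. increment (N i) n \<omega> = \<delta> i}"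

text \<open>Augmentation is by the measurable null sets of \<open>M\<close>, so that the result is a
  sub-\<open>\<sigma>\<close>-algebra of \<open>M\<close> even if \<open>M\<close> is not complete. Only the underlying
  \<open>\<sigma>\<close>-algebra of the measure space built here is used.\<close>

definition augmented_natural_filtration ::
    "'a measure \<Rightarrow> nat \<Rightarrow> (nat \<Rightarrow> nat \<Rightarrow> 'a \<Rightarrow> nat) \<Rightarrow> nat \<Rightarrow> 'a measure" where
  "augmented_natural_filtration M \<rho> N n =
     sigma (space M)
       ({N i m -` A \<inter> space M | i m A. i \<in> {1..\<rho>} \<and> m \<le> n} \<union> null_sets M)"

definition cond_indep_var ::
    "'a measure \<Rightarrow> 'a measure \<Rightarrow> 'b measure \<Rightarrow> ('a \<Rightarrow> 'b) \<Rightarrow> 'c measure \<Rightarrow> ('a \<Rightarrow> 'c) \<Rightarrow> bool" where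
  "cond_indep_var M G S X T Y \<longleftrightarrow>
     X \<in> M \<rightarrow>\<^sub>M S \<and> Y \<in> M \<rightarrow>\<^sub>M T \<and>
     (\<forall>A\<in>sets S. \<forall>B\<in>sets T. AE \<omega> in M.
        real_cond_exp M G (indicator {\<omega> \<in> space M. X \<omega> \<in> A \<and> Y \<omega> \<in> B}) \<omega> =
        real_cond_exp M G (indicator {\<omega> \<in> space M. X \<omega> \<in> A}) \<omega> *
        real_cond_exp M G (indicator {\<omega> \<in> space M. Y \<omega> \<in> B}) \<omega>)"

definition Theta_tilde ::
    "'a measure \<Rightarrow> (nat \<Rightarrow> 'a measure) \<Rightarrow> (nat \<Rightarrow> 'a \<Rightarrow> real) \<Rightarrow> nat \<Rightarrow> 'a \<Rightarrow> real" where
  "Theta_tilde M F \<Theta> k = real_cond_exp M (F k) (\<Theta> (Suc k))"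

definition jump_intensity ::
    "'a measure \<Rightarrow> (nat \<Rightarrow> 'a measure) \<Rightarrow> nat \<Rightarrow> (nat \<Rightarrow> nat \<Rightarrow> 'a \<Rightarrow> nat) \<Rightarrow>
      (nat \<Rightarrow> nat) \<Rightarrow> nat \<Rightarrow> 'a \<Rightarrow> real" where
  "jump_intensity M F \<rho> N \<delta> k =
     real_cond_exp M (F k) (indicator (increment_event M \<rho> N (Suc k) \<delta>))"

definition filtered ::
    "'a measure \<Rightarrow> nat \<Rightarrow> (nat \<Rightarrow> nat \<Rightarrow> 'a \<Rightarrow> nat) \<Rightarrow> (nat \<Rightarrow> 'a \<Rightarrow> real) \<Rightarrow> nat \<Rightarrow> 'a \<Rightarrow> real" where
  "filtered M \<rho> N X k = real_cond_exp M (augmented_natural_filtration M \<rho> N k) (X k)"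

end

theory Submission
  imports Defs
begin

text \<open>
  Let \<open>D = {\<Delta>N\<^sub>n = \<delta>}\<close>. Given \<open>D\<close>, the vector \<open>N\<^sub>n\<close> is determined by \<open>N\<^sub>n\<^sub>-\<^sub>1\<close>, so the observation
  \<open>\<sigma>\<close>-algebras at times \<open>n\<close> and \<open>n - 1\<close> have the same trace on \<open>D\<close>. Hence on \<open>D\<close> conditioning at time
  \<open>n\<close> reduces to Bayes' formula \<open>E[\<Theta>\<^sub>n 1\<^sub>D | \<F>\<^sup>N\<^sub>n\<^sub>-\<^sub>1] / P[D | \<F>\<^sup>N\<^sub>n\<^sub>-\<^sub>1]\<close>. Conditional independence gives
  \<open>E[\<Theta>\<^sub>n 1\<^sub>D | \<F>\<^sub>n\<^sub>-\<^sub>1] = \<Theta>~\<^sub>n\<^sub>-\<^sub>1 \<lambda>\<^sup>\<delta>\<^sub>n\<^sub>-\<^sub>1\<close>, and the tower property turns the quotient into the claimed one. The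
  augmented \<open>\<F>\<^sup>N\<^sub>n\<^sub>-\<^sub>1\<close> is contained in \<open>\<F>\<^sub>n\<^sub>-\<^sub>1\<close> only up to null sets, which the tower property tolerates.
\<close>

section \<open>Conditional probabilities and conditional independence\<close>

lemma (in finite_measure) integrable_indicator_real:
  "A \<in> sets M \<Longrightarrow> integrable M (indicat_real A)"
  by (intro integrable_real_indicator) (auto simp: less_top[symmetric])

lemma (in finite_measure_subalgebra) cond_prob_bounds:
  assumes [measurable]: "D \<in> sets M"
  shows "AE \<omega> in M. 0 \<le> real_cond_exp M F (indicator D) \<omega> \<and> real_cond_exp M F (indicator D) \<omega> \<le> 1"
proof -
  have "AE \<omega> in M. 0 \<le> real_cond_exp M F (indicator D) \<omega>"
    by (rule real_cond_exp_pos) auto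
  moreover have "AE \<omega> in M. real_cond_exp M F (indicator D) \<omega> \<le> real_cond_exp M F (\<lambda>_. 1) \<omega>"
    by (rule real_cond_exp_mono) (use integrable_indicator_real[OF assms] in \<open>simp_all add: indicator_le_1\<close>)
  moreover have "AE \<omega> in M. real_cond_exp M F (\<lambda>_. 1) \<omega> = 1"
    by (rule real_cond_exp_F_meas) auto
  ultimately show ?thesis by eventually_elim auto
qed

text \<open>The conditional probability lies in [0,1] almost surely, so \<open>X\<close> dominates
  the product; for two arbitrary integrable factors the product could fail to be integrable.\<close>

lemma (in finite_measure_subalgebra) integrable_mult_cond_prob:
  assumes D: "D \<in> sets M" and X: "integrable M X"
  shows "integrable M (\<lambda>\<omega>. real_cond_exp M F (indicator D) \<omega> * X \<omega>)"
proof (rule Bochner_Integration.integrable_bound[OF X])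
  show "AE \<omega> in M. norm (real_cond_exp M F (indicator D) \<omega> * X \<omega>) \<le> norm (X \<omega>)"
    using cond_prob_bounds[OF D]
    by eventually_elim (auto simp: abs_mult intro!: mult_left_le_one_le)
qed (use X in measurable)

text \<open>The hypothesis says that the measures with densities \<open>f\<close> and \<open>g\<close> have the same image under \<open>X\<close>; this
  extends conditional independence from events \<open>{X \<in> A}\<close> to \<open>X\<close> itself without approximation.\<close>

lemma integral_mult_eq_if_weights_agree:
  fixes X f g :: "'a \<Rightarrow> real"
  assumes [measurable]: "X \<in> borel_measurable M" and f: "integrable M f" and g: "integrable M g"
    and f_nn: "AE \<omega> in M. 0 \<le> f \<omega>" and g_nn: "AE \<omega> in M. 0 \<le> g \<omega>"
    and eq: "\<And>A. A \<in> sets borel \<Longrightarrow>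
      (\<integral>\<omega>. f \<omega> * indicator (X -` A \<inter> space M) \<omega> \<partial>M) = (\<integral>\<omega>. g \<omega> * indicator (X -` A \<inter> space M) \<omega> \<partial>M)"
  shows "(\<integral>\<omega>. f \<omega> * X \<omega> \<partial>M) = (\<integral>\<omega>. g \<omega> * X \<omega> \<partial>M)"
proof -
  have distr: "emeasure (distr (density M h) borel X) A
      = ennreal (\<integral>\<omega>. h \<omega> * indicator (X -` A \<inter> space M) \<omega> \<partial>M)"
    if h: "integrable M h" "AE \<omega> in M. 0 \<le> h \<omega>" and A: "A \<in> sets borel" for h A
  proof -
    have hm[measurable]: "h \<in> borel_measurable M" using h(1) by simp
    have XA[measurable]: "X -` A \<inter> space M \<in> sets M" using A by measurable
    have "emeasure (distr (density M h) borel X) A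
        = (\<integral>\<^sup>+\<omega>. ennreal (h \<omega>) * indicator (X -` A \<inter> space M) \<omega> \<partial>M)"
      using A by (simp add: emeasure_distr emeasure_density)
    also have "\<dots> = (\<integral>\<^sup>+\<omega>. ennreal (h \<omega> * indicator (X -` A \<inter> space M) \<omega>) \<partial>M)"
      by (intro nn_integral_cong) (auto simp: indicator_def)
    also have "\<dots> = ennreal (\<integral>\<omega>. h \<omega> * indicator (X -` A \<inter> space M) \<omega> \<partial>M)"
      using h by (intro nn_integral_eq_integral integrable_real_mult_indicator) (auto simp: indicator_def)
    finally show ?thesis .
  qed
  have "distr (density M f) borel X = distr (density M g) borel X"
    by (rule measure_eqI) (use f g f_nn g_nn eq in \<open>auto simp: distr\<close>)
  \<comment> \<open>If \<open>h * X\<close> is not integrable, both integrals take the default value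
    0, so equality of the image measures settles every case.\<close>
  moreover have "(\<integral>x. x \<partial>distr (density M h) borel X) = (\<integral>\<omega>. h \<omega> * X \<omega> \<partial>M)"
    if h: "integrable M h" "AE \<omega> in M. 0 \<le> h \<omega>" for h
    using h by (simp add: integral_distr integral_density)
  ultimately show ?thesis using f g f_nn g_nn by metis
qed

text \<open>Testing against \<open>C\<close> in \<open>F\<close> leaves an identity between the
  integrals of \<open>X\<close> with weights \<open>indicator (C \<inter> D)\<close> and
  \<open>indicator C * P[D | F]\<close>. Conditional independence yields it for indicators of events
  \<open>{X \<in> A}\<close>, and the preceding lemma passes from these events to
  \<open>X\<close>.\<close>

lemma (in finite_measure_subalgebra) cond_exp_mult_indicator_if_cond_indep:
  assumes X: "integrable M X" and indep: "cond_indep_var M F borel X T Y" and B: "B \<in> sets T"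
  defines "D \<equiv> {\<omega> \<in> space M. Y \<omega> \<in> B}"
  shows "AE \<omega> in M. real_cond_exp M F (\<lambda>\<omega>. X \<omega> * indicator D \<omega>) \<omega>
    = real_cond_exp M F X \<omega> * real_cond_exp M F (indicator D) \<omega>"
proof (rule real_cond_exp_charact)
  have Xm[measurable]: "X \<in> borel_measurable M" using X by simp
  have Ym[measurable]: "Y \<in> M \<rightarrow>\<^sub>M T" using indep by (simp add: cond_indep_var_def)
  have Dm[measurable]: "D \<in> sets M" unfolding D_def using B by measurable
  let ?L = "real_cond_exp M F (indicator D)"
  have Lint: "integrable M ?L"
    by (intro real_cond_exp_int integrable_indicator_real Dm)
  have LXint: "integrable M (\<lambda>\<omega>. ?L \<omega> * X \<omega>)"
    by (rule integrable_mult_cond_prob[OF Dm X])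
  show "integrable M (\<lambda>\<omega>. X \<omega> * indicator D \<omega>)"
    by (intro integrable_real_mult_indicator X Dm)
  \<comment> \<open>\<open>?L\<close> is \<open>F\<close>-measurable, so integrability of
    \<open>?L * X\<close> carries over when \<open>X\<close> is replaced by its conditional
    expectation.\<close>
  show "integrable M (\<lambda>\<omega>. real_cond_exp M F X \<omega> * ?L \<omega>)"
    using real_cond_exp_intg(1)[OF LXint] by (simp add: mult.commute)
  fix C assume C[measurable]: "C \<in> sets F"
  then have Cm[measurable]: "C \<in> sets M" using subalg by (auto simp: subalgebra_def)
  have "(\<integral>\<omega>. indicator (C \<inter> D) \<omega> * X \<omega> \<partial>M) = (\<integral>\<omega>. (indicator C \<omega> * ?L \<omega>) * X \<omega> \<partial>M)"
  proof (rule integral_mult_eq_if_weights_agree)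
    show "integrable M (indicat_real (C \<inter> D))"
      by (rule integrable_indicator_real) measurable
    show "integrable M (\<lambda>\<omega>. indicator C \<omega> * ?L \<omega>)"
      using integrable_mult_indicator[OF Cm Lint] by simp
    show "AE \<omega> in M. 0 \<le> indicator C \<omega> * ?L \<omega>"
      using cond_prob_bounds[OF Dm] by eventually_elim simp
    fix A :: "real set" assume A[measurable]: "A \<in> sets borel"
    let ?E = "X -` A \<inter> space M"
    have Em[measurable]: "?E \<in> sets M" by measurable
    have intE: "integrable M (indicat_real ?E)"
      by (rule integrable_indicator_real) measurable
    have intED: "integrable M (indicat_real (?E \<inter> D))"
      by (rule integrable_indicator_real) measurable
    have E_eq: "{\<omega> \<in> space M. X \<omega> \<in> A} = ?E" "{\<omega> \<in> space M. X \<omega> \<in> A \<and> Y \<omega> \<in> B} = ?E \<inter> D"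
      by (auto simp: D_def)
    have ind: "AE \<omega> in M. real_cond_exp M F (indicator (?E \<inter> D)) \<omega>
        = real_cond_exp M F (indicator ?E) \<omega> * ?L \<omega>"
    proof -
      have "AE \<omega> in M. real_cond_exp M F (indicator {\<omega> \<in> space M. X \<omega> \<in> A \<and> Y \<omega> \<in> B}) \<omega>
          = real_cond_exp M F (indicator {\<omega> \<in> space M. X \<omega> \<in> A}) \<omega> * real_cond_exp M F (indicator {\<omega> \<in> space M. Y \<omega> \<in> B}) \<omega>"
        using indep A B unfolding cond_indep_var_def by blast
      then show ?thesis unfolding E_eq D_def[symmetric] .
    qed
    have LE: "integrable M (\<lambda>\<omega>. (indicator C \<omega> * ?L \<omega>) * indicator ?E \<omega>)"
      using integrable_mult_indicator[OF Cm integrable_mult_cond_prob[OF Dm intE]] by (simp add: mult.assoc)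
    have "(\<integral>\<omega>. indicat_real (C \<inter> D) \<omega> * indicator ?E \<omega> \<partial>M)
        = (\<integral>\<omega>. indicator C \<omega> * indicator (?E \<inter> D) \<omega> \<partial>M)"
      by (intro Bochner_Integration.integral_cong) (auto simp: indicator_def)
    also have "\<dots> = (\<integral>\<omega>. indicator C \<omega> * real_cond_exp M F (indicator (?E \<inter> D)) \<omega> \<partial>M)"
      by (rule real_cond_exp_intg(2)[symmetric])
        (use integrable_mult_indicator[OF Cm intED] in simp_all)
    also have "\<dots> = (\<integral>\<omega>. (indicator C \<omega> * ?L \<omega>) * real_cond_exp M F (indicator ?E) \<omega> \<partial>M)"
      by (intro integral_cong_AE borel_measurable_times borel_measurable_indicator Cm Em
          borel_measurable_cond_exp2) (use ind in \<open>eventually_elim, auto\<close>)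
    \<comment> \<open>The weight \<open>indicator C * ?L\<close> is \<open>F\<close>-measurable, so
      the conditional expectation of \<open>indicator ?E\<close> may be replaced by
      \<open>indicator ?E\<close> itself.\<close>
    also have "\<dots> = (\<integral>\<omega>. (indicator C \<omega> * ?L \<omega>) * indicator ?E \<omega> \<partial>M)"
      by (rule real_cond_exp_intg(2)[OF LE]) measurable
    finally show "(\<integral>\<omega>. indicat_real (C \<inter> D) \<omega> * indicator ?E \<omega> \<partial>M)
        = (\<integral>\<omega>. (indicator C \<omega> * ?L \<omega>) * indicator ?E \<omega> \<partial>M)" .
  qed auto
  also have "\<dots> = (\<integral>\<omega>. (indicator C \<omega> * ?L \<omega>) * real_cond_exp M F X \<omega> \<partial>M)"
    by (rule real_cond_exp_intg(2)[symmetric])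
      (use integrable_mult_indicator[OF Cm LXint] in \<open>simp_all add: mult.assoc\<close>)
  finally show "(\<integral>\<omega>\<in>C. X \<omega> * indicator D \<omega> \<partial>M) = (\<integral>\<omega>\<in>C. real_cond_exp M F X \<omega> * ?L \<omega> \<partial>M)"
    by (simp add: set_lebesgue_integral_def indicator_inter_arith mult_ac)
qed measurable

section \<open>The tower property modulo null sets and Bayes' formula\<close>

text \<open>An event \<open>A\<close> of \<open>G\<close> and its substitute \<open>B\<close> in
  \<open>F\<close> give the same integrals, so the defining property of conditioning on
  \<open>F\<close>, applied to \<open>B\<close>, can be transferred to \<open>A\<close>.\<close>

lemma (in finite_measure) cond_exp_tower_mod_null_sets:
  assumes F: "subalgebra M F" and G: "subalgebra M G"
    and mod_null: "\<And>A. A \<in> sets G \<Longrightarrow> \<exists>B\<in>sets F. sym_diff A B \<in> null_sets M"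
    and X: "integrable M X"
  shows "AE \<omega> in M. real_cond_exp M G (real_cond_exp M F X) \<omega> = real_cond_exp M G X \<omega>"
proof -
  interpret F: finite_measure_subalgebra M F by unfold_locales (fact F)
  interpret G: finite_measure_subalgebra M G by unfold_locales (fact G)
  show ?thesis
  proof (rule G.real_cond_exp_charact)
    fix A assume A: "A \<in> sets G"
    obtain B where B: "B \<in> sets F" "sym_diff A B \<in> null_sets M" using mod_null[OF A] by blast
    have [measurable]: "A \<in> sets M" "B \<in> sets M" using A B F G by (auto simp: subalgebra_def)
    have ae: "AE \<omega> in M. \<omega> \<notin> sym_diff A B" using B(2) by (rule AE_not_in)
    have AB: "(\<integral>\<omega>\<in>A. Z \<omega> \<partial>M) = (\<integral>\<omega>\<in>B. Z \<omega> \<partial>M)" if [measurable]: "Z \<in> borel_measurable M" for Z :: "'a \<Rightarrow> real"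
      unfolding set_lebesgue_integral_def
      by (rule integral_cong_AE; (measurable)?) (use ae in \<open>eventually_elim, auto simp: indicator_def\<close>)
    have "(\<integral>\<omega>\<in>A. real_cond_exp M F X \<omega> \<partial>M) = (\<integral>\<omega>\<in>B. real_cond_exp M F X \<omega> \<partial>M)"
      by (rule AB) simp
    also have "\<dots> = (\<integral>\<omega>\<in>B. X \<omega> \<partial>M)" using F.real_cond_exp_intA[OF X B(1)] by simp
    also have "\<dots> = (\<integral>\<omega>\<in>A. X \<omega> \<partial>M)" using X by (simp add: AB)
    also have "\<dots> = (\<integral>\<omega>\<in>A. real_cond_exp M G X \<omega> \<partial>M)" by (rule G.real_cond_exp_intA[OF X A])
    finally show "(\<integral>\<omega>\<in>A. real_cond_exp M F X \<omega> \<partial>M) = (\<integral>\<omega>\<in>A. real_cond_exp M G X \<omega> \<partial>M)" .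
  qed (use X in auto)
qed

text \<open>Inside \<open>D\<close> the larger \<open>G'\<close> distinguishes nothing beyond
  \<open>G\<close>. An integral over an event of \<open>G'\<close> whose integrand vanishes off
  \<open>D\<close> is therefore an integral over an event of \<open>G\<close>, where the conditional
  expectations given \<open>G\<close> can be used.\<close>

lemma (in finite_measure) cond_exp_eq_quotient_on_atom:
  assumes G: "subalgebra M G" and G': "subalgebra M G'" and GG': "subalgebra G' G"
    and D: "D \<in> sets G'"
    and trace: "\<And>B. B \<in> sets G' \<Longrightarrow> \<exists>A\<in>sets G. B \<inter> D = A \<inter> D"
    and X: "integrable M X"
  shows "AE \<omega> in M. \<omega> \<in> D \<longrightarrow> real_cond_exp M G' X \<omega>
    = real_cond_exp M G (\<lambda>\<omega>. X \<omega> * indicator D \<omega>) \<omega> / real_cond_exp M G (indicator D) \<omega>"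
proof -
  interpret G: finite_measure_subalgebra M G by unfold_locales (fact G)
  interpret G': finite_measure_subalgebra M G' by unfold_locales (fact G')
  have Xm[measurable]: "X \<in> borel_measurable M" using X by simp
  have Dm[measurable]: "D \<in> sets M" using D G' by (auto simp: subalgebra_def)
  note D[measurable]
  define L where "L = real_cond_exp M G (indicator D)"
  define H where "H = real_cond_exp M G (\<lambda>\<omega>. X \<omega> * indicator D \<omega>)"
  have XD: "integrable M (\<lambda>\<omega>. X \<omega> * indicator D \<omega>)"
    by (intro integrable_real_mult_indicator X Dm)
  have L[measurable]: "L \<in> borel_measurable G" and H[measurable]: "H \<in> borel_measurable G"
    by (simp_all add: L_def H_def)
  have [measurable]: "L \<in> borel_measurable G'" "H \<in> borel_measurable G'"
    using L H GG' by (auto intro: measurable_from_subalg)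
  have [measurable]: "L \<in> borel_measurable M" "H \<in> borel_measurable M"
    using L H G by (auto intro: measurable_from_subalg)
  have Lint: "integrable M (\<lambda>\<omega>. L \<omega> * Z \<omega>)" if "integrable M Z" for Z
    unfolding L_def by (rule G.integrable_mult_cond_prob[OF Dm that])
  have Hint: "integrable M H" unfolding H_def by (rule G.real_cond_exp_int[OF XD])
  have HD: "integrable M (\<lambda>\<omega>. H \<omega> * indicator D \<omega>)"
    by (intro integrable_real_mult_indicator Hint Dm)

  \<comment> \<open>The division-free form \<open>L E[X 1\<^sub>D | G'] = H 1\<^sub>D\<close> is shown first: \<open>H / L\<close> need not be bounded, so the
    integrability of \<open>H / L\<close> on \<open>D\<close> is not available a priori.\<close>
  have "AE \<omega> in M. real_cond_exp M G' (\<lambda>\<omega>. L \<omega> * (X \<omega> * indicator D \<omega>)) \<omega> = H \<omega> * indicator D \<omega>"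
  proof (rule G'.real_cond_exp_charact)
    fix B assume B: "B \<in> sets G'"
    obtain A where A[measurable]: "A \<in> sets G" and BA: "B \<inter> D = A \<inter> D" using trace[OF B] by blast
    have Am[measurable]: "A \<in> sets M" using A G by (auto simp: subalgebra_def)
    have ind: "indicator B \<omega> * indicator D \<omega> = (indicator A \<omega> * indicator D \<omega> :: real)" for \<omega>
      using BA by (auto simp: indicator_def)
    have "(\<integral>\<omega>\<in>B. L \<omega> * (X \<omega> * indicator D \<omega>) \<partial>M)
        = (\<integral>\<omega>. (L \<omega> * X \<omega>) * (indicator B \<omega> * indicator D \<omega>) \<partial>M)"
      by (simp add: set_lebesgue_integral_def mult_ac)
    also have "\<dots> = (\<integral>\<omega>. (indicator A \<omega> * L \<omega>) * (X \<omega> * indicator D \<omega>) \<partial>M)"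
      unfolding ind by (simp add: mult_ac)
    also have "\<dots> = (\<integral>\<omega>. (indicator A \<omega> * L \<omega>) * H \<omega> \<partial>M)"
      unfolding H_def
      by (rule G.real_cond_exp_intg(2)[symmetric])
        (use integrable_mult_indicator[OF Am Lint[OF XD]] in \<open>simp_all add: mult.assoc\<close>)
    \<comment> \<open>The roles are now exchanged: \<open>H\<close> joins the
      \<open>G\<close>-measurable weight, and \<open>L\<close> is turned back into
      \<open>indicator D\<close>.\<close>
    also have "\<dots> = (\<integral>\<omega>. (indicator A \<omega> * H \<omega>) * L \<omega> \<partial>M)"
      by (simp add: mult_ac)
    also have "\<dots> = (\<integral>\<omega>. (indicator A \<omega> * H \<omega>) * indicator D \<omega> \<partial>M)"
      unfolding L_def
      by (rule G.real_cond_exp_intg(2))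
        (use integrable_mult_indicator[OF Am HD] in \<open>simp_all add: mult.assoc\<close>)
    also have "\<dots> = (\<integral>\<omega>. H \<omega> * (indicator B \<omega> * indicator D \<omega>) \<partial>M)"
      unfolding ind by (simp add: mult_ac)
    finally show "(\<integral>\<omega>\<in>B. L \<omega> * (X \<omega> * indicator D \<omega>) \<partial>M) = (\<integral>\<omega>\<in>B. H \<omega> * indicator D \<omega> \<partial>M)"
      by (simp add: set_lebesgue_integral_def mult_ac)
  qed (use Lint[OF XD] HD in auto)
  \<comment> \<open>\<open>L * indicator D\<close> is \<open>G'\<close>-measurable because
    \<open>D\<close> belongs to \<open>G'\<close>, so it can be pulled out of the conditional
    expectation.\<close>
  moreover have "AE \<omega> in M. real_cond_exp M G' (\<lambda>\<omega>. (L \<omega> * indicator D \<omega>) * X \<omega>) \<omega>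
      = (L \<omega> * indicator D \<omega>) * real_cond_exp M G' X \<omega>"
    by (rule G'.real_cond_exp_mult) (use Lint[OF XD] in \<open>simp_all add: mult_ac\<close>)
  ultimately have prod: "AE \<omega> in M. \<omega> \<in> D \<longrightarrow> L \<omega> * real_cond_exp M G' X \<omega> = H \<omega>"
    by eventually_elim (auto simp: mult_ac)

  \<comment> \<open>Division by \<open>L\<close> is legitimate almost surely on \<open>D\<close>:
    the set \<open>?Z\<close> is in \<open>G\<close>, so the measure of \<open>?Z \<inter> D\<close>
    is the integral of \<open>L\<close> over \<open>?Z\<close>, which is 0.\<close>
  let ?Z = "{\<omega> \<in> space M. L \<omega> = 0}"
  have "space G = space M" using G by (simp add: subalgebra_def)
  moreover have "{\<omega> \<in> space G. L \<omega> = 0} \<in> sets G" by measurable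
  ultimately have Z[measurable]: "?Z \<in> sets G" by simp
  have Zm[measurable]: "?Z \<in> sets M" by measurable
  have intD: "integrable M (indicat_real D)"
    by (rule integrable_indicator_real) measurable
  have "(\<integral>\<omega>\<in>?Z. indicator D \<omega> \<partial>M) = (\<integral>\<omega>\<in>?Z. L \<omega> \<partial>M)"
    unfolding L_def[symmetric] using G.real_cond_exp_intA[OF intD Z] by (simp add: L_def)
  also have "\<dots> = (\<integral>\<omega>. 0 \<partial>M)"
    unfolding set_lebesgue_integral_def by (intro Bochner_Integration.integral_cong) (auto simp: indicator_def)
  finally have "measure M (?Z \<inter> D) = 0"
    by (simp add: set_lebesgue_integral_def indicator_inter_arith[symmetric])
  then have "?Z \<inter> D \<in> null_sets M" by (intro null_setsI) (auto simp: emeasure_eq_measure)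
  then have "AE \<omega> in M. \<omega> \<notin> ?Z \<inter> D" by (rule AE_not_in)
  with prod AE_space show ?thesis
    unfolding L_def[symmetric] H_def[symmetric] by eventually_elim (auto simp: field_simps)
qed

section \<open>The augmented natural filtration\<close>

lemma sets_augmented_natural_filtration:
  "sets (augmented_natural_filtration M \<rho> N n) = sigma_sets (space M)
    ({N i m -` A \<inter> space M | i m A. i \<in> {1..\<rho>} \<and> m \<le> n} \<union> null_sets M)"
  unfolding augmented_natural_filtration_def
  by (rule sets_measure_of) (auto dest: sets.sets_into_space)

lemma space_augmented_natural_filtration [simp]:
  "space (augmented_natural_filtration M \<rho> N n) = space M"
  by (simp add: augmented_natural_filtration_def space_measure_of_conv)


lemma subalgebra_augmented_natural_filtration:
  assumes "\<And>i m. i \<in> {1..\<rho>} \<Longrightarrow> m \<le> n \<Longrightarrow> N i m \<in> M \<rightarrow>\<^sub>M count_space UNIV"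
  shows "subalgebra M (augmented_natural_filtration M \<rho> N n)"
proof -
  have "{N i m -` A \<inter> space M | i m A. i \<in> {1..\<rho>} \<and> m \<le> n} \<union> null_sets M \<subseteq> sets M"
    using assms by (auto intro!: measurable_sets)
  then show ?thesis
    by (simp add: subalgebra_def sets_augmented_natural_filtration sets.sigma_sets_subset)
qed

lemma augmented_natural_filtration_mono:
  assumes "m \<le> n"
  shows "subalgebra (augmented_natural_filtration M \<rho> N n) (augmented_natural_filtration M \<rho> N m)"
  unfolding subalgebra_def sets_augmented_natural_filtration
  using assms by (auto intro!: sigma_sets_mono' order_trans[OF _ assms])

lemma measurable_augmented_natural_filtration:
  assumes "i \<in> {1..\<rho>}" "m \<le> n"
  shows "N i m \<in> augmented_natural_filtration M \<rho> N n \<rightarrow>\<^sub>M count_space UNIV"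
proof (rule measurableI)
  fix A :: "nat set"
  show "N i m -` A \<inter> space (augmented_natural_filtration M \<rho> N n) \<in> sets (augmented_natural_filtration M \<rho> N n)"
    using assms by (auto simp: sets_augmented_natural_filtration intro!: sigma_sets.Basic)
qed simp

text \<open>Agreeing with a member of \<open>F\<close> up to a null set is preserved by complements
  and countable unions, so only generators have to be checked.\<close>

lemma sigma_sets_sym_diff_null_sets:
  assumes A: "A \<in> sigma_sets (space M) \<A>"
    and F: "subalgebra M F"
    and gen: "\<And>A. A \<in> \<A> \<Longrightarrow> \<exists>B\<in>sets F. sym_diff A B \<in> null_sets M"
    and \<A>: "\<A> \<subseteq> sets M"
  shows "\<exists>B\<in>sets F. sym_diff A B \<in> null_sets M"
  using A
proof induction
  case (Basic A)
  then show ?case by (rule gen)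
next
  case Empty
  show ?case by (intro bexI[of _ "{}"]) auto
next
  case (Compl A)
  then obtain B where B: "B \<in> sets F" "sym_diff A B \<in> null_sets M" by blast
  have "A \<subseteq> space M" using Compl.hyps sets.sigma_sets_subset[OF \<A>] sets.sets_into_space by blast
  moreover have "B \<subseteq> space M" "space F = space M"
    using B(1) F sets.sets_into_space[of B F] by (auto simp: subalgebra_def)
  ultimately have "sym_diff (space M - A) (space F - B) = sym_diff A B" by auto
  then show ?case using B by (intro bexI[of _ "space F - B"]) auto
next
  case (Union A)
  then obtain B where B: "\<And>i. B i \<in> sets F" "\<And>i. sym_diff (A i) (B i) \<in> null_sets M" by metis
  have "(\<Union>i. sym_diff (A i) (B i)) \<in> null_sets M" using B(2) by blast
  \<comment> \<open>\<open>M\<close> need not be complete, so a subset of a null set is null only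
    once its measurability has been shown.\<close>
  moreover have "A i \<in> sets M" "B i \<in> sets M" for i
    using Union.hyps sets.sigma_sets_subset[OF \<A>] B(1) F by (auto simp: subalgebra_def)
  then have "sym_diff (\<Union>i. A i) (\<Union>i. B i) \<in> sets M" by auto
  ultimately have "sym_diff (\<Union>i. A i) (\<Union>i. B i) \<in> null_sets M"
    by (rule null_sets_subset) blast
  then show ?case using B(1) by (intro bexI[of _ "\<Union>i. B i"]) auto
qed

text \<open>Having the same trace on \<open>D\<close> as a member of \<open>G\<close> is preserved
  by complements and countable unions, so again generators suffice.\<close>

lemma sigma_sets_trace:
  assumes B: "B \<in> sigma_sets \<Omega> \<B>" and \<Omega>: "\<Omega> = space G" and D: "D \<subseteq> \<Omega>"
    and gen: "\<And>B. B \<in> \<B> \<Longrightarrow> \<exists>A\<in>sets G. B \<inter> D = A \<inter> D"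
  shows "\<exists>A\<in>sets G. B \<inter> D = A \<inter> D"
  using B
proof induction
  case (Basic B)
  then show ?case by (rule gen)
next
  case Empty
  show ?case by (intro bexI[of _ "{}"]) auto
next
  case (Compl B)
  then obtain A where A: "A \<in> sets G" "B \<inter> D = A \<inter> D" by blast
  then show ?case using D \<Omega> by (intro bexI[of _ "\<Omega> - A"]) auto
next
  case (Union B)
  then obtain A where A: "\<And>i. A i \<in> sets G" "\<And>i. B i \<inter> D = A i \<inter> D" by metis
  then show ?case by (intro bexI[of _ "\<Union>i. A i"]) auto
qed

text \<open>Generators coming from \<open>N\<close> already lie in \<open>F\<close>, and a null set
  is replaced by the empty set. This supplies the hypothesis of the tower property modulo null
  sets.\<close>

lemma augmented_natural_filtration_mod_null_sets:
  assumes F: "subalgebra M F"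
    and N: "\<And>i m. i \<in> {1..\<rho>} \<Longrightarrow> m \<le> n \<Longrightarrow> N i m \<in> F \<rightarrow>\<^sub>M count_space UNIV"
    and A: "A \<in> sets (augmented_natural_filtration M \<rho> N n)"
  shows "\<exists>B\<in>sets F. sym_diff A B \<in> null_sets M"
proof (rule sigma_sets_sym_diff_null_sets[OF A[unfolded sets_augmented_natural_filtration] F])
  let ?\<A> = "{N i m -` A \<inter> space M | i m A. i \<in> {1..\<rho>} \<and> m \<le> n}"
  have sp: "space F = space M" and sub: "sets F \<subseteq> sets M" using F by (auto simp: subalgebra_def)
  have *: "?\<A> \<subseteq> sets F"
    using N unfolding sp[symmetric] by (auto intro!: measurable_sets)
  then show "?\<A> \<union> null_sets M \<subseteq> sets M" using sub by auto
  fix A assume "A \<in> ?\<A> \<union> null_sets M"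
  then show "\<exists>B\<in>sets F. sym_diff A B \<in> null_sets M"
  proof
    assume "A \<in> ?\<A>"
    then show ?thesis using * by (intro bexI[of _ A]) auto
  next
    assume "A \<in> null_sets M"
    then show ?thesis by (intro bexI[of _ "{}"]) auto
  qed
qed

text \<open>Only the generators at time \<open>Suc k\<close> are new, and on the jump event they are
  generators at time \<open>k\<close> for a translated set of values.\<close>

lemma augmented_natural_filtration_trace:
  assumes mono: "\<And>i \<omega>. i \<in> {1..\<rho>} \<Longrightarrow> \<omega> \<in> space M \<Longrightarrow> N i k \<omega> \<le> N i (Suc k) \<omega>"
    and B: "B \<in> sets (augmented_natural_filtration M \<rho> N (Suc k))"
  shows "\<exists>A\<in>sets (augmented_natural_filtration M \<rho> N k).
    B \<inter> increment_event M \<rho> N (Suc k) \<delta> = A \<inter> increment_event M \<rho> N (Suc k) \<delta>"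
proof (rule sigma_sets_trace[OF B[unfolded sets_augmented_natural_filtration]])
  let ?G = "augmented_natural_filtration M \<rho> N k" and ?D = "increment_event M \<rho> N (Suc k) \<delta>"
  show "?D \<subseteq> space M" by (auto simp: increment_event_def)
  fix B assume "B \<in> {N i m -` A \<inter> space M | i m A. i \<in> {1..\<rho>} \<and> m \<le> Suc k} \<union> null_sets M"
  then consider i m S where "B = N i m -` S \<inter> space M" "i \<in> {1..\<rho>}" "m \<le> k"
    | i S where "B = N i (Suc k) -` S \<inter> space M" "i \<in> {1..\<rho>}"
    | "B \<in> null_sets M"
    by (auto simp: le_Suc_eq)
  then show "\<exists>A\<in>sets ?G. B \<inter> ?D = A \<inter> ?D"
  proof cases
    case (1 i m S)
    then show ?thesis
      by (intro bexI[of _ B]) (auto simp: sets_augmented_natural_filtration intro!: sigma_sets.Basic)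
  next
    case (2 i S)
    \<comment> \<open>The values in \<open>S\<close> are shifted back by the known jump
      \<open>\<delta> i\<close>.\<close>
    let ?A = "N i k -` {x. x + \<delta> i \<in> S} \<inter> space M"
    \<comment> \<open>Monotone paths make the truncated subtraction in \<open>increment\<close>
      exact, so it can be inverted.\<close>
    have "N i (Suc k) \<omega> = N i k \<omega> + \<delta> i" if "\<omega> \<in> ?D" for \<omega>
    proof -
      have "increment (N i) (Suc k) \<omega> = \<delta> i" "\<omega> \<in> space M"
        using that 2(2) unfolding increment_event_def by blast+
      then show ?thesis using mono[OF 2(2), of \<omega>] by (simp add: increment_def)
    qed
    then have "B \<inter> ?D = ?A \<inter> ?D" using 2(1) by auto
    moreover have "?A \<in> sets ?G"
      using 2(2) unfolding sets_augmented_natural_filtration by (intro sigma_sets.Basic) blast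
    ultimately show ?thesis by blast
  next
    case 3
    then show ?thesis
      by (intro bexI[of _ B]) (auto simp: sets_augmented_natural_filtration intro!: sigma_sets.Basic)
  qed
qed simp

section \<open>Jump events and jump supports\<close>

lemma increment_event_in_sets:
  assumes "\<And>i m. i \<in> {1..\<rho>} \<Longrightarrow> m \<le> n \<Longrightarrow> N i m \<in> G \<rightarrow>\<^sub>M count_space UNIV" "space G = space M"
  shows "increment_event M \<rho> N n \<delta> \<in> sets G"
proof -
  have "{\<omega> \<in> space G. \<forall>i\<in>{1..\<rho>}. N i n \<omega> - N i (n - 1) \<omega> = \<delta> i} \<in> sets G"
  proof (rule sets.sets_Collect_finite_All)
    fix i assume "i \<in> {1..\<rho>}"
    then have [measurable]: "N i n \<in> G \<rightarrow>\<^sub>M count_space UNIV" "N i (n - 1) \<in> G \<rightarrow>\<^sub>M count_space UNIV"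
      by (auto intro: assms)
    show "{\<omega> \<in> space G. N i n \<omega> - N i (n - 1) \<omega> = \<delta> i} \<in> sets G" by measurable
  qed auto
  then show ?thesis using assms(2) by (simp add: increment_event_def increment_def)
qed

text \<open>\<open>increment_vec\<close> only takes extensional values, so for any other
  \<open>\<delta>\<close> the right-hand side would be empty. The preimage form is the one to which
  conditional independence applies.\<close>

lemma increment_event_eq_increment_vec:
  assumes "\<delta> \<in> extensional {1..\<rho>}"
  shows "increment_event M \<rho> N n \<delta> = {\<omega> \<in> space M. increment_vec \<rho> N n \<omega> = \<delta>}"
proof -
  have "increment_vec \<rho> N n \<omega> = \<delta> \<longleftrightarrow> (\<forall>i\<in>{1..\<rho>}. increment (N i) n \<omega> = \<delta> i)" for \<omega>
  proof
    assume "increment_vec \<rho> N n \<omega> = \<delta>"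
    then show "\<forall>i\<in>{1..\<rho>}. increment (N i) n \<omega> = \<delta> i" by (auto simp: increment_vec_def)
  next
    assume "\<forall>i\<in>{1..\<rho>}. increment (N i) n \<omega> = \<delta> i"
    then show "increment_vec \<rho> N n \<omega> = \<delta>"
      by (intro extensionalityI[OF _ assms]) (simp_all add: increment_vec_def)
  qed
  then show ?thesis by (simp add: increment_event_def)
qed

text \<open>Each value outside the support is taken only on a null set, and there are countably many
  natural numbers.\<close>

lemma (in finite_measure) AE_increment_in_support:
  assumes "X n \<in> M \<rightarrow>\<^sub>M count_space UNIV" "X (n - 1) \<in> M \<rightarrow>\<^sub>M count_space UNIV"
  shows "AE \<omega> in M. increment X n \<omega> \<in> increment_support M X n"
proof -
  note assms[measurable]
  have "AE \<omega> in M. increment X n \<omega> = k \<longrightarrow> k \<in> increment_support M X n" for k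
  proof (cases "k \<in> increment_support M X n")
    case False
    then have "measure M {\<omega> \<in> space M. increment X n \<omega> = k} = 0"
      by (simp add: increment_support_def zero_less_measure_iff)
    moreover have "{\<omega> \<in> space M. increment X n \<omega> = k} \<in> sets M"
      unfolding increment_def by measurable
    ultimately have "{\<omega> \<in> space M. increment X n \<omega> = k} \<in> null_sets M"
      by (intro null_setsI) (auto simp: emeasure_eq_measure)
    then show ?thesis by (rule AE_I'[OF _]) auto
  qed simp
  then have "AE \<omega> in M. \<forall>k. increment X n \<omega> = k \<longrightarrow> k \<in> increment_support M X n"
    by (subst AE_all_countable) blast
  then show ?thesis by eventually_elim simp
qed

text \<open>At \<open>\<omega>\<close> every summand vanishes except possibly that of the realised
  jump vector, so no summability question arises even for infinite \<open>J i\<close>.\<close>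

lemma infsum_indicator_increment_event:
  assumes "\<omega> \<in> space M" "\<And>i. i \<in> {1..\<rho>} \<Longrightarrow> increment (N i) n \<omega> \<in> J i"
  shows "(\<Sum>\<^sub>\<infinity>\<delta>\<in>(\<Pi>\<^sub>E i\<in>{1..\<rho>}. J i). f \<delta> * indicator (increment_event M \<rho> N n \<delta>) \<omega>)
    = (f (increment_vec \<rho> N n \<omega>) :: real)"
proof -
  have "indicator (increment_event M \<rho> N n \<delta>) \<omega> = (of_bool (\<delta> = increment_vec \<rho> N n \<omega>) :: real)"
    if "\<delta> \<in> (\<Pi>\<^sub>E i\<in>{1..\<rho>}. J i)" for \<delta>
    using that assms(1)
    by (subst increment_event_eq_increment_vec) (auto simp: PiE_def)
  moreover have "increment_vec \<rho> N n \<omega> \<in> (\<Pi>\<^sub>E i\<in>{1..\<rho>}. J i)"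
    using assms(2) by (simp add: increment_vec_def)
  ultimately have "(\<Sum>\<^sub>\<infinity>\<delta>\<in>(\<Pi>\<^sub>E i\<in>{1..\<rho>}. J i). f \<delta> * indicator (increment_event M \<rho> N n \<delta>) \<omega>)
      = (\<Sum>\<^sub>\<infinity>\<delta>\<in>{increment_vec \<rho> N n \<omega>}. f \<delta>)"
    by (intro infsum_cong_neutral) auto
  then show ?thesis by simp
qed

section \<open>The one-step filter formula\<close>

theorem proposition9:
  fixes M :: "'a measure"
    and F :: "nat \<Rightarrow> 'a measure"
    and \<Gamma> \<rho> :: nat
    and N :: "nat \<Rightarrow> nat \<Rightarrow> 'a \<Rightarrow> nat"
    and J :: "nat \<Rightarrow> nat set"
    and \<Theta> :: "nat \<Rightarrow> 'a \<Rightarrow> real"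
  assumes "prob_space M"
    and "discrete_filtration M \<Gamma> F"
    and "\<rho> \<ge> 1"
    and "\<And>i. i \<in> {1..\<rho>} \<Longrightarrow> counting_process (space M) \<Gamma> (N i)"
    and "\<And>i n. i \<in> {1..\<rho>} \<Longrightarrow> n \<le> \<Gamma> \<Longrightarrow> N i n \<in> F n \<rightarrow>\<^sub>M count_space UNIV"
    and "\<And>i n. i \<in> {1..\<rho>} \<Longrightarrow> n \<in> {1..\<Gamma>} \<Longrightarrow> J i = increment_support M (N i) n"
    and "\<And>i. i \<in> {1..\<rho>} \<Longrightarrow> 0 \<in> J i"
    and "\<And>n. n \<le> \<Gamma> \<Longrightarrow> \<Theta> n \<in> borel_measurable (F n)"
    and "\<And>n. n \<le> \<Gamma> \<Longrightarrow> integrable M (\<lambda>\<omega>. (\<Theta> n \<omega>)\<^sup>2)"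
    and "\<And>n. n \<in> {1..\<Gamma>} \<Longrightarrow>
          cond_indep_var M (F (n - 1)) borel (\<Theta> n)
            (\<Pi>\<^sub>M i\<in>{1..\<rho>}. count_space UNIV) (increment_vec \<rho> N n)"
  shows "AE \<omega> in M. \<forall>n\<in>{1..\<Gamma>}.
    filtered M \<rho> N \<Theta> n \<omega> =
    (\<Sum>\<^sub>\<infinity>\<delta> \<in> (\<Pi>\<^sub>E i\<in>{1..\<rho>}. J i).
       filtered M \<rho> N (\<lambda>k \<omega>. Theta_tilde M F \<Theta> k \<omega> * jump_intensity M F \<rho> N \<delta> k \<omega>) (n - 1) \<omega>
       / filtered M \<rho> N (jump_intensity M F \<rho> N \<delta>) (n - 1) \<omega>
       * indicator (increment_event M \<rho> N n \<delta>) \<omega>)"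
proof (rule AE_ball_countable', goal_cases)
  case (1 n)
  interpret prob_space M by fact
  note n = 1
  \<comment> \<open>\<open>Theta_tilde\<close> and \<open>jump_intensity\<close> at index
    \<open>k\<close> concern the step from \<open>k\<close> to \<open>Suc k\<close>, so
    \<open>k\<close> is the index \<open>n - 1\<close> of the statement.\<close>
  then obtain k where nk: "n = Suc k" by (cases n) auto
  let ?G = "augmented_natural_filtration M \<rho> N"
  have F: "subalgebra M (F m)" if "m \<le> \<Gamma>" for m
    using assms(2) that by (simp add: discrete_filtration_def)
  have F_mono: "subalgebra (F k) (F m)" if "m \<le> k" for m
    using assms(2) that n nk by (simp add: discrete_filtration_def)
  have N_F: "N i m \<in> F k \<rightarrow>\<^sub>M count_space UNIV" if "i \<in> {1..\<rho>}" "m \<le> k" for i m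
    using measurable_from_subalg[OF F_mono assms(5)[of i m]] that n nk by simp
  have N_M: "N i m \<in> M \<rightarrow>\<^sub>M count_space UNIV" if "i \<in> {1..\<rho>}" "m \<le> n" for i m
    using measurable_from_subalg[OF F[of m] assms(5)[of i m]] that n by simp
  have Fk: "subalgebra M (F k)" using F n nk by simp
  have Gn: "subalgebra M (?G n)" and Gk: "subalgebra M (?G k)"
    by (rule subalgebra_augmented_natural_filtration; use N_M nk in simp)+
  interpret F: finite_measure_subalgebra M "F k" by unfold_locales (fact Fk)
  interpret G: finite_measure_subalgebra M "?G k" by unfold_locales (fact Gk)
  have "\<Theta> n \<in> borel_measurable M"
    using measurable_from_subalg[OF F assms(8)] n by simp
  then have \<Theta>: "integrable M (\<Theta> n)"
    by (rule square_integrable_imp_integrable) (use assms(9)[of n] n in simp)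
  have mono: "N i k \<omega> \<le> N i (Suc k) \<omega>" if "i \<in> {1..\<rho>}" "\<omega> \<in> space M" for i \<omega>
    using assms(4)[OF that(1)] that(2) n nk by (simp add: counting_process_def)
  have tower: "AE \<omega> in M. real_cond_exp M (?G k) (real_cond_exp M (F k) X) \<omega> = real_cond_exp M (?G k) X \<omega>"
    if "integrable M X" for X
    using Fk Gk augmented_natural_filtration_mod_null_sets[OF Fk N_F] that
    by (rule cond_exp_tower_mod_null_sets)

  let ?q = "\<lambda>\<delta> \<omega>. filtered M \<rho> N (\<lambda>k \<omega>. Theta_tilde M F \<Theta> k \<omega> * jump_intensity M F \<rho> N \<delta> k \<omega>) k \<omega>
       / filtered M \<rho> N (jump_intensity M F \<rho> N \<delta>) k \<omega>"
  have "AE \<omega> in M. \<omega> \<in> increment_event M \<rho> N n \<delta> \<longrightarrow> filtered M \<rho> N \<Theta> n \<omega> = ?q \<delta> \<omega>"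
    if \<delta>: "\<delta> \<in> (\<Pi>\<^sub>E i\<in>{1..\<rho>}. J i)" for \<delta>
  proof -
    let ?D = "increment_event M \<rho> N n \<delta>"
    have D_G: "?D \<in> sets (?G n)"
      by (intro increment_event_in_sets measurable_augmented_natural_filtration) auto
    then have Dm: "?D \<in> sets M" using Gn by (auto simp: subalgebra_def)
    \<comment> \<open>Conditional independence speaks of measurable sets of jump vectors;
      extensionality of \<open>\<delta>\<close> makes its singleton a finite product of singletons,
      hence measurable.\<close>
    have "{\<delta>} = (\<Pi>\<^sub>E i\<in>{1..\<rho>}. {\<delta> i})" using \<delta> by (intro PiE_singleton[symmetric]) (auto simp: PiE_def)
    then have sing: "{\<delta>} \<in> sets (\<Pi>\<^sub>M i\<in>{1..\<rho>}. count_space UNIV)" by (simp add: sets_PiM_I_finite)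
    have D_eq: "?D = {\<omega> \<in> space M. increment_vec \<rho> N n \<omega> \<in> {\<delta>}}"
      using increment_event_eq_increment_vec[of \<delta> \<rho>] \<delta> by (simp add: PiE_def)
    have \<Theta>D: "integrable M (\<lambda>\<omega>. \<Theta> n \<omega> * indicator ?D \<omega>)"
      by (intro integrable_real_mult_indicator \<Theta> Dm)
    \<comment> \<open>This is the only place where conditional independence of
      \<open>\<Theta> n\<close> and the jumps enters.\<close>
    have "AE \<omega> in M. real_cond_exp M (F k) (\<lambda>\<omega>. \<Theta> n \<omega> * indicator ?D \<omega>) \<omega>
        = Theta_tilde M F \<Theta> k \<omega> * jump_intensity M F \<rho> N \<delta> k \<omega>"
      using F.cond_exp_mult_indicator_if_cond_indep[OF \<Theta> _ sing] assms(10)[OF n]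
      unfolding Theta_tilde_def jump_intensity_def nk D_eq[unfolded nk] by simp
    then have "AE \<omega> in M. real_cond_exp M (?G k) (real_cond_exp M (F k) (\<lambda>\<omega>. \<Theta> n \<omega> * indicator ?D \<omega>)) \<omega>
        = filtered M \<rho> N (\<lambda>k \<omega>. Theta_tilde M F \<Theta> k \<omega> * jump_intensity M F \<rho> N \<delta> k \<omega>) k \<omega>"
      unfolding filtered_def
      by (rule G.real_cond_exp_cong) (simp_all add: Theta_tilde_def jump_intensity_def)
    moreover have "AE \<omega> in M. filtered M \<rho> N (jump_intensity M F \<rho> N \<delta>) k \<omega> = real_cond_exp M (?G k) (indicator ?D) \<omega>"
      using tower[OF integrable_indicator_real[OF Dm]]
      by (simp add: filtered_def jump_intensity_def nk)
    moreover have "AE \<omega> in M. \<omega> \<in> ?D \<longrightarrow> real_cond_exp M (?G n) (\<Theta> n) \<omega>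
        = real_cond_exp M (?G k) (\<lambda>\<omega>. \<Theta> n \<omega> * indicator ?D \<omega>) \<omega> / real_cond_exp M (?G k) (indicator ?D) \<omega>"
    proof (rule cond_exp_eq_quotient_on_atom[OF Gk Gn _ D_G _ \<Theta>])
      show "subalgebra (?G n) (?G k)" by (rule augmented_natural_filtration_mono) (simp add: nk)
      show "\<exists>A\<in>sets (?G k). B \<inter> ?D = A \<inter> ?D" if "B \<in> sets (?G n)" for B
        using augmented_natural_filtration_trace[OF mono that[unfolded nk]] unfolding nk .
    qed
    ultimately show ?thesis
      using tower[OF \<Theta>D] unfolding filtered_def by eventually_elim simp
  qed
  \<comment> \<open>The exceptional null set depends on \<open>\<delta>\<close>; a common one exists
    since finitely many components with values in sets of naturals give countably many
    vectors.\<close>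
  then have "AE \<omega> in M. \<forall>\<delta>\<in>(\<Pi>\<^sub>E i\<in>{1..\<rho>}. J i). \<omega> \<in> increment_event M \<rho> N n \<delta> \<longrightarrow> filtered M \<rho> N \<Theta> n \<omega> = ?q \<delta> \<omega>"
    by (intro AE_ball_countable' countable_PiE) auto
  moreover have "AE \<omega> in M. \<forall>i\<in>{1..\<rho>}. increment (N i) n \<omega> \<in> J i"
  proof (intro AE_ball_countable')
    fix i assume i: "i \<in> {1..\<rho>}"
    show "AE \<omega> in M. increment (N i) n \<omega> \<in> J i"
      unfolding assms(6)[OF i n] using i by (intro AE_increment_in_support N_M) auto
  qed auto
  ultimately show ?case
    using AE_space
  proof eventually_elim
    case (elim \<omega>)
    \<comment> \<open>Off the null sets, the identity is used for the jump vector realised at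
      \<open>\<omega>\<close>, the one whose term survives in the sum.\<close>
    let ?\<delta> = "increment_vec \<rho> N n \<omega>"
    have "?\<delta> \<in> (\<Pi>\<^sub>E i\<in>{1..\<rho>}. J i)" "\<omega> \<in> increment_event M \<rho> N n ?\<delta>"
      using elim by (auto simp: increment_vec_def increment_event_def)
    then have "filtered M \<rho> N \<Theta> n \<omega> = ?q ?\<delta> \<omega>" using elim(1) by blast
    moreover have "n - 1 = k" using nk by simp
    ultimately show ?case
      using elim by (simp only: infsum_indicator_increment_event)
  qed
qed simp

end
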